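(* Let $I=[a,b]$ be a compact interval and let $F\in\mathcal{PM}(I,I)$ have forts $c_1<\dots<c_v$, with $c_0:=a$ and $c_{v+1}:=b$. Suppose $H(F)=1$, that the characteristic interval of $F$ is the first lap, $K(F)=[c_0,c_1]$, and that $F$ is strictly increasing on $[c_0,c_1]$. Suppose that there is a point $c_u\in\{c_4,c_5,\dots,c_{v+1}\}$ with $F(c_u)=c_0$, let $c_u$ denote the smallest such point, and suppose that $F(c_3)=\max_{x\in[c_0,c_u]}F(x)$. Put $M:=\max_{x\in I}F(x)$, and suppose that at least one of the following three conditions holds: (1) $F(c_2)=c_0=F(c_0)$ and $F(c_1)<F(c_3)<c_1=M$; (2) $c_0<F(c_2)<F(c_0)$ and $F(c_3)=c_1=F(c_1)$; (3) $c_0<F(c_2)<F(c_0)$ and $F(c_1)<F(c_3)<c_1$. Then there exists a continuous function $f:I\to I$ with $f\circ f=F$ on $I$ and $H(f)=2$ such that $f$ is strictly increasing on $[c_0,c_1]$.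
   Context: Let $I=[a,b]$ be a compact interval. A continuous map $F:I\to I$ is a piecewise monotone (PM) function if it has only finitely many forts (non-monotone points), where a fort is a point of $(a,b)$ in no neighbourhood of which $F$ is strictly monotone. If the forts are $c_1<\dots<c_v$, put $c_0:=a$, $c_{v+1}:=b$; then $F$ is strictly monotone on each $[c_i,c_{i+1}]$, $0\le i\le v$, and these subintervals are called the laps of $F$. $\mathcal{PM}(I,I)$ is the set of all PM functions $I\to I$, and $N(F)$ is the number of forts of $F$ (so $N(F)=v$, and $N(F^0)=0$, where $F^0$ is the identity and $F^i$ is the $i$-th iterate). The sequence $N(F^0)\le N(F)\le N(F^2)\le\cdots$ is nondecreasing; the height $H(F)$ is the smallest integer $i\ge 0$ with $N(F^i)=N(F^{i+1})$, and $H(F)=\infty$ if there is none. When $H(F)=1$, there is a lap of $F$ containing the range $F(I)$; this lap is called the characteristic interval $K(F)$. (Conversely, existence of a lap covering the range characterizes $H(F)=1$ for maps having forts.) *)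

theory Defs
  imports "HOL-Analysis.Analysis" "HOL-Library.Extended_Nat"
begin

(* A self-map of the interval [a,b] is represented by a function on all of the reals.  Every notion
   below depends only on its values on [a,b]. *)

definition strictly_monotone_on :: "real set \<Rightarrow> (real \<Rightarrow> real) \<Rightarrow> bool" where
  "strictly_monotone_on S F \<longleftrightarrow> strict_mono_on S F \<or> strict_antimono_on S F"

definition forts :: "real \<Rightarrow> real \<Rightarrow> (real \<Rightarrow> real) \<Rightarrow> real set" where
  "forts a b F = {x \<in> {a<..<b}.
     \<not> (\<exists>U. open U \<and> x \<in> U \<and> strictly_monotone_on (U \<inter> {a..b}) F)}"

definition PM :: "real \<Rightarrow> real \<Rightarrow> (real \<Rightarrow> real) set" where
  "PM a b = {F. continuous_on {a..b} F \<and> F ` {a..b} \<subseteq> {a..b} \<and> finite (forts a b F)}"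

(* Meaningful for members of PM a b only: card of an infinite set is 0. *)
definition num_forts :: "real \<Rightarrow> real \<Rightarrow> (real \<Rightarrow> real) \<Rightarrow> nat" where
  "num_forts a b F = card (forts a b F)"

definition height :: "real \<Rightarrow> real \<Rightarrow> (real \<Rightarrow> real) \<Rightarrow> enat" where
  "height a b F =
     (if \<exists>i. num_forts a b (F ^^ i) = num_forts a b (F ^^ Suc i)
      then enat (LEAST i. num_forts a b (F ^^ i) = num_forts a b (F ^^ Suc i))
      else \<infinity>)"

(* The intervals between consecutive points of a < c_1 < ... < c_v < b, where c_1, ..., c_v are
   the forts. *)
definition laps :: "real \<Rightarrow> real \<Rightarrow> (real \<Rightarrow> real) \<Rightarrow> real set set" where
  "laps a b F = {{x..y} |x y. x \<in> insert a (insert b (forts a b F)) \<and>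
     y \<in> insert a (insert b (forts a b F)) \<and> x < y \<and> {x<..<y} \<inter> forts a b F = {}}"

(* "K is the characteristic interval of F", used for maps of height 1.  A relation rather than a
   function; K is unique when a < b and F is in PM a b, since the range of F is then a
   nondegenerate interval and distinct laps share at most one point. *)
definition is_characteristic_interval ::
    "real \<Rightarrow> real \<Rightarrow> (real \<Rightarrow> real) \<Rightarrow> real set \<Rightarrow> bool" where
  "is_characteristic_interval a b F K \<longleftrightarrow> K \<in> laps a b F \<and> F ` {a..b} \<subseteq> K"

definition is_maximum_on :: "real set \<Rightarrow> (real \<Rightarrow> real) \<Rightarrow> real \<Rightarrow> bool" where
  "is_maximum_on S F m \<longleftrightarrow> m \<in> F ` S \<and> (\<forall>x\<in>S. F x \<le> m)"

end

theory Submission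
  imports Defs
begin

text \<open>
  Let \<open>K = [c\<^sub>0, c\<^sub>1]\<close>, \<open>e = F(c\<^sub>2)\<close> and \<open>d = F(c\<^sub>3)\<close>. Under each of the three conditions
  the increasing map \<open>F|K\<close> has an increasing square root \<open>\<phi>\<close> with \<open>\<phi>(c\<^sub>0) = e\<close> and
  \<open>\<phi>(c\<^sub>1) = d\<close>: each end is either fixed or moved strictly part of the way towards its image.
  Put \<open>A = \<phi>\<^sup>-\<^sup>1 \<circ> F\<close> on \<open>[c\<^sub>0, c\<^sub>3]\<close>, which extends \<open>\<phi>\<close>. It maps \<open>[c\<^sub>1, c\<^sub>2]\<close> decreasingly onto
  \<open>[c\<^sub>0, d]\<close> and \<open>[c\<^sub>2, c\<^sub>3]\<close> increasingly onto \<open>K\<close>. The root \<open>f\<close> equals \<open>A\<close> on \<open>[c\<^sub>0, c\<^sub>3]\<close>,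
  \<open>(A|[c\<^sub>1, c\<^sub>2])\<^sup>-\<^sup>1 \<circ> F\<close> on \<open>[c\<^sub>3, c\<^sub>u]\<close> and \<open>(A|[c\<^sub>2, c\<^sub>3])\<^sup>-\<^sup>1 \<circ> F\<close> on \<open>[c\<^sub>u, b]\<close>. All forts of \<open>f\<close> are
  forts of \<open>F\<close>, but \<open>c\<^sub>3\<close> is not a fort of \<open>f\<close>, so \<open>f\<close> has fewer forts than \<open>f\<^sup>2 = F\<close>; and \<open>f\<^sup>3 = f \<circ> F\<close>
  has the same forts as \<open>F\<close> because \<open>f\<close> is increasing on \<open>K\<close>, which contains the range of \<open>F\<close>.

  For the square root, extend \<open>F|K\<close> to an increasing homeomorphism \<open>G\<close> of the line. On each
  component of the set of non-fixed points \<open>G\<close> is conjugate to translation by 1, with the image of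
  one prescribed point under translation by 1/2 at our disposal. Gluing the components together
  gives a strictly increasing root, which is automatically continuous.
\<close>

section \<open>Increasing square roots of homeomorphisms of the line\<close>

text \<open>Negative exponents iterate the inverse, so the orbit of a point becomes one bi-infinite
  sequence that can be indexed by the floor of a real parameter.\<close>

definition int_iter :: "('a \<Rightarrow> 'a) \<Rightarrow> int \<Rightarrow> 'a \<Rightarrow> 'a" where
  "int_iter G k = (if k \<ge> 0 then G ^^ nat k else inv G ^^ nat (- k))"

lemma int_iter_0 [simp]: "int_iter G 0 x = x"
  by (simp add: int_iter_def)

lemma int_iter_of_nat: "int_iter G (int n) x = (G ^^ n) x"
  by (simp add: int_iter_def)

lemma int_iter_minus_of_nat: "int_iter G (- int n) x = (inv G ^^ n) x"
  by (cases "n = 0") (auto simp: int_iter_def)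

lemma int_iter_add1:
  assumes "bij G"
  shows "int_iter G (k + 1) x = G (int_iter G k x)"
proof (cases "k \<ge> 0")
  case True
  then show ?thesis by (simp add: int_iter_def nat_add_distrib)
next
  case False
  then obtain n where k: "k = - int (Suc n)"
    by (metis int_cases of_nat_0_le_iff)
  have "int_iter G (k + 1) x = (inv G ^^ n) x"
    unfolding k using int_iter_minus_of_nat[of G n x] by simp
  moreover have "int_iter G k x = inv G ((inv G ^^ n) x)"
    unfolding k int_iter_minus_of_nat by simp
  ultimately show ?thesis
    using assms by (simp add: bij_is_surj surj_f_inv_f)
qed

lemma int_iter_commute:
  assumes "bij G"
  shows "int_iter G k (G x) = int_iter G (k + 1) x"
proof (induction k rule: int_induct[where k = 0])
  case base
  show ?case using int_iter_add1[OF assms, of 0 x] by simp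
next
  case (step1 i)
  then show ?case by (metis int_iter_add1[OF assms])
next
  case (step2 i)
  \<comment> \<open>Going down, \<open>G\<close> is applied to both sides of the goal and then
    cancelled by injectivity.\<close>
  have "G (int_iter G (i - 1) (G x)) = G (int_iter G (i - 1 + 1) x)"
    using step2 int_iter_add1[OF assms, of "i - 1" "G x"] int_iter_add1[OF assms, of i x] by simp
  then show ?case using assms by (metis bij_is_inj injD)
qed

lemma int_iter_strict_mono_surj:
  fixes G :: "real \<Rightarrow> real"
  assumes "bij G" "strict_mono G"
  shows "strict_mono (int_iter G k) \<and> surj (int_iter G k)"
proof (induction k rule: int_induct[where k = 0])
  case base
  have "int_iter G 0 = id" by auto
  then show ?case by (simp add: strict_mono_def)
next
  case (step1 i)
  have "int_iter G (i + 1) = G \<circ> int_iter G i" using int_iter_add1[OF assms(1)] by auto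
  moreover have "surj (G \<circ> int_iter G i)" using step1 bij_is_surj[OF assms(1)] by (intro comp_surj) auto
  ultimately show ?case using step1 assms by (simp add: strict_mono_def)
next
  case (step2 i)
  have *: "int_iter G (i - 1) = inv G \<circ> int_iter G i"
    using int_iter_add1[OF assms(1), of "i - 1"] assms(1) by (auto simp: bij_is_inj)
  have "strict_mono (inv G)"
    by (rule strict_mono_inv[of G]) (use assms in \<open>auto simp: bij_is_inj bij_is_surj surj_f_inv_f\<close>)
  moreover have "surj (inv G \<circ> int_iter G i)"
    using step2 bij_is_surj[OF bij_imp_bij_inv[OF assms(1)]] by (intro comp_surj) auto
  ultimately show ?case using step2 unfolding * by (simp add: strict_mono_def)
qed

text \<open>If \<open>x\<close> is not fixed, this is the connected component of the open set of
  non-fixed points that contains \<open>x\<close>; if \<open>x\<close> is fixed, it is empty. Taking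
  \<open>min\<close> and \<open>max\<close> covers points on both sides of \<open>x\<close>.\<close>

definition nonfixed_component :: "(real \<Rightarrow> real) \<Rightarrow> real \<Rightarrow> real set" where
  "nonfixed_component G x = {y. \<forall>z\<in>{min x y..max x y}. G z \<noteq> z}"

text \<open>A bounded increasing orbit would converge, and by continuity its limit would be a fixed
  point in \<open>[x, y]\<close>.\<close>

lemma iterates_exceed:
  fixes G :: "real \<Rightarrow> real"
  assumes cont: "continuous_on UNIV G" and mono: "strict_mono G" and x: "x < G x"
    and nf: "\<And>z. z \<in> {x..y} \<Longrightarrow> G z \<noteq> z"
  shows "\<exists>n. y < (G ^^ n) x"
proof (rule ccontr)
  assume "\<nexists>n. y < (G ^^ n) x"
  then have le: "(G ^^ n) x \<le> y" for n by (simp add: not_less)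
  have step: "(G ^^ n) x < (G ^^ Suc n) x" for n
    by (induction n) (use x mono in \<open>auto simp: strict_mono_def\<close>)
  then have inc: "incseq (\<lambda>n. (G ^^ n) x)" by (intro incseq_SucI) (simp add: less_imp_le)
  obtain L where L: "(\<lambda>n. (G ^^ n) x) \<longlonglongrightarrow> L"
    using incseq_convergent[OF inc] le by metis
  have "(\<lambda>n. G ((G ^^ n) x)) \<longlonglongrightarrow> G L"
    using cont L by (metis continuous_on_eq_continuous_at isCont_tendsto_compose open_UNIV UNIV_I)
  moreover have "(\<lambda>n. G ((G ^^ n) x)) \<longlonglongrightarrow> L"
    using LIMSEQ_Suc[OF L] by simp
  ultimately have "G L = L" by (rule LIMSEQ_unique)
  moreover have "x \<le> L" using incseq_le[OF inc L, of 0] by simp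
  moreover have "L \<le> y" using L le by (meson LIMSEQ_le_const2)
  ultimately show False using nf by auto
qed

lemma inverse_iterates_fall_below:
  fixes G :: "real \<Rightarrow> real"
  assumes cont: "continuous_on UNIV G" and mono: "strict_mono G" and bij: "bij G" and x: "x < G x"
    and nf: "\<And>z. z \<in> {y..x} \<Longrightarrow> G z \<noteq> z"
  shows "\<exists>n. (inv G ^^ n) x \<le> y"
proof (rule ccontr)
  assume "\<nexists>n. (inv G ^^ n) x \<le> y"
  then have le: "y \<le> (inv G ^^ n) x" for n by (simp add: not_le less_imp_le)
  have G_inv: "G (inv G z) = z" for z using bij by (simp add: bij_is_surj surj_f_inv_f)
  have inv_less: "inv G y < inv G z \<longleftrightarrow> y < z" for y z
    using strict_mono_less[OF mono, of "inv G y" "inv G z"] by (simp add: G_inv)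
  have step: "(inv G ^^ Suc n) x < (inv G ^^ n) x" for n
  proof (induction n)
    case 0
    show ?case using inv_less[of x "G x"] x bij by (simp add: bij_is_inj)
  next
    case (Suc n)
    then show ?case using inv_less by simp
  qed
  then have dec: "decseq (\<lambda>n. (inv G ^^ n) x)" by (intro decseq_SucI) (simp add: less_imp_le)
  obtain L where L: "(\<lambda>n. (inv G ^^ n) x) \<longlonglongrightarrow> L"
    using decseq_convergent[OF dec] le by metis
  \<comment> \<open>Applying \<open>G\<close> to the shifted sequence returns the sequence itself,
    so continuity of \<open>G\<close> makes the limit a fixed point.\<close>
  have "(\<lambda>n. G ((inv G ^^ Suc n) x)) \<longlonglongrightarrow> G L"
    using cont LIMSEQ_Suc[OF L] by (metis continuous_on_eq_continuous_at isCont_tendsto_compose open_UNIV UNIV_I)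
  moreover have "(\<lambda>n. G ((inv G ^^ Suc n) x)) \<longlonglongrightarrow> L"
    using L by (simp add: G_inv)
  ultimately have "G L = L" by (rule LIMSEQ_unique)
  moreover have "L \<le> x" using decseq_ge[OF dec L, of 0] by simp
  moreover have "y \<le> L" using L le by (meson LIMSEQ_le_const)
  ultimately show False using nf by auto
qed

text \<open>The inverse of \<open>\<beta>\<close> solves Abel's equation. The orbit of
  \<open>x\<close> cuts the component into images of the fundamental domain \<open>[x, G x)\<close>,
  so a parametrization of that domain over \<open>[0, 1)\<close> determines \<open>\<beta>\<close>.
  The parameter 1/2 lies inside the domain, which leaves the value \<open>m\<close> there
  free.\<close>

lemma abel_parametrization:
  fixes G :: "real \<Rightarrow> real"
  assumes cont: "continuous_on UNIV G" and mono: "strict_mono G" and bij: "bij G"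
    and m: "x < m" "m < G x"
  obtains \<beta> :: "real \<Rightarrow> real" where "strict_mono \<beta>" "range \<beta> = nonfixed_component G x"
    "\<And>s. \<beta> (s + 1) = G (\<beta> s)" "\<beta> 0 = x" "\<beta> (1 / 2) = m"
proof -
  \<comment> \<open>\<open>p\<close> is affine from \<open>x\<close> to \<open>m\<close> up to 1/2
    and affine with slope \<open>2 * (G x - m)\<close> beyond, so that it reaches \<open>G x\<close>
    at 1.\<close>
  define p where "p r = (if r \<le> 1 / 2 then x + 2 * r * (m - x) else m + (2 * r - 1) * (G x - m))" for r :: real
  have p_mono: "p r < p s" if "r < s" for r s
  proof -
    consider "s \<le> 1 / 2" | "r \<le> 1 / 2" "s > 1 / 2" | "r > 1 / 2" by linarith
    then show ?thesis
    proof cases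
      case 1
      then show ?thesis using that m by (simp add: p_def)
    next
      case 2
      have "2 * r * (m - x) \<le> 1 * (m - x)" using 2 m by (intro mult_right_mono) auto
      moreover have "0 < (2 * s - 1) * (G x - m)" using 2 m by (intro mult_pos_pos) auto
      ultimately show ?thesis using 2 by (simp add: p_def)
    next
      case 3
      then show ?thesis using that m by (simp add: p_def)
    qed
  qed
  have p_surj: "\<exists>r. 0 \<le> r \<and> r < 1 \<and> p r = y" if y: "x \<le> y" "y < G x" for y
  proof (cases "y \<le> m")
    case True
    define r where "r = (y - x) / (2 * (m - x))"
    have "0 \<le> r" "r \<le> 1 / 2" using True y m by (auto simp: r_def divide_simps)
    moreover have "2 * r * (m - x) = y - x" using m by (simp add: r_def field_simps)
    ultimately show ?thesis by (intro exI[of _ r]) (auto simp: p_def)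
  next
    case False
    define r where "r = 1 / 2 + (y - m) / (2 * (G x - m))"
    have "1 / 2 < r" "r < 1" using False y m by (auto simp: r_def divide_simps)
    moreover have "(2 * r - 1) * (G x - m) = y - m" using m by (simp add: r_def field_simps)
    ultimately show ?thesis by (intro exI[of _ r]) (auto simp: p_def)
  qed
  have p0: "p 0 = x" "p 1 = G x" "p (1 / 2) = m" by (auto simp: p_def)
  define \<beta> where "\<beta> s = int_iter G \<lfloor>s\<rfloor> (p (frac s))" for s
  have it_mono: "int_iter G k y < int_iter G k z" if "y < z" for k y z
    using int_iter_strict_mono_surj[OF bij mono, of k] that by (simp add: strict_mono_def)
  have it_less: "int_iter G k y < int_iter G k z \<longleftrightarrow> y < z" for k y z
    by (metis it_mono linorder_neqE_linordered_idom order_less_asym')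
  have it_x_step: "int_iter G k x < int_iter G (k + 1) x" for k
    using it_mono[of x "G x" k] m by (simp add: int_iter_commute[OF bij])
  have it_x_strict: "int_iter G k x < int_iter G l x" if "k < l" for k l
    using that
  proof (induction l rule: int_gr_induct)
    case base
    show ?case by (rule it_x_step)
  next
    case (step i)
    then show ?case using it_x_step[of i] by linarith
  qed
  have it_x_mono: "int_iter G k x \<le> int_iter G l x" if "k \<le> l" for k l
    using it_x_strict[of k l] that by (cases "k = l") auto
  have \<beta>_lower: "int_iter G \<lfloor>s\<rfloor> x \<le> \<beta> s" for s
  proof (cases "frac s = 0")
    case True
    then show ?thesis by (simp only: \<beta>_def p0)
  next
    case False
    then have "x < p (frac s)" using frac_ge_0[of s] p_mono[of 0 "frac s"] p0(1) by linarith
    then show ?thesis unfolding \<beta>_def by (intro less_imp_le it_mono)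
  qed
  have \<beta>_upper: "\<beta> s < int_iter G (\<lfloor>s\<rfloor> + 1) x" for s
    using p_mono[of "frac s" 1] it_mono[of "p (frac s)" "G x" "\<lfloor>s\<rfloor>"] p0 frac_lt_1[of s]
    by (auto simp: \<beta>_def int_iter_commute[OF bij])
  have "\<beta> s < \<beta> t" if "s < t" for s t
  proof (cases "\<lfloor>s\<rfloor> = \<lfloor>t\<rfloor>")
    case True
    then have "frac s < frac t" using that by (simp add: frac_def)
    then show ?thesis using True it_mono p_mono by (simp add: \<beta>_def)
  next
    case False
    then have "\<lfloor>s\<rfloor> + 1 \<le> \<lfloor>t\<rfloor>" using that floor_mono[of s t] by linarith
    then show ?thesis using \<beta>_upper[of s] \<beta>_lower[of t] it_x_mono by (meson less_le_trans)
  qed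
  then have "strict_mono \<beta>" by (simp add: strict_mono_def)
  moreover have "\<beta> (s + 1) = G (\<beta> s)" for s
    by (simp add: \<beta>_def int_iter_add1[OF bij] frac_def)
  moreover have "\<beta> 0 = x" "\<beta> (1 / 2) = m"
    by (auto simp: \<beta>_def p0 frac_def)
  moreover have "range \<beta> = nonfixed_component G x"
  proof (intro equalityI subsetI)
    fix y assume "y \<in> range \<beta>"
    then obtain s where s: "y = \<beta> s" by auto
    have False if z: "z \<in> {min x y..max x y}" "G z = z" for z
    proof -
      \<comment> \<open>A fixed point stays put under all integer iterates, so by monotonicity the
        orbit of \<open>x\<close> cannot cross it; the orbit bounds on \<open>\<beta> s\<close> then
        keep \<open>\<beta> s\<close> on the same side.\<close>
      have fix_it: "int_iter G k z = z" for k
      proof (induction k rule: int_induct[where k = 0])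
        case base
        show ?case by simp
      next
        case (step1 i)
        then show ?case using z(2) by (simp add: int_iter_add1[OF bij])
      next
        case (step2 i)
        then show ?case using z(2) int_iter_add1[OF bij, of "i - 1" z] bij
          by (metis bij_is_inj diff_add_cancel injD)
      qed
      show False
      proof (cases "x < z")
        case True
        then have "int_iter G (\<lfloor>s\<rfloor> + 1) x < z" using it_mono fix_it by metis
        then show False using \<beta>_upper[of s] True z s by auto
      next
        case False
        then have "z < x" using m z(2) by (cases "z = x") auto
        then have "z < int_iter G \<lfloor>s\<rfloor> x" using it_mono fix_it by metis
        then show False using \<beta>_lower[of s] \<open>z < x\<close> z s by auto
      qed
    qed
    then show "y \<in> nonfixed_component G x" unfolding nonfixed_component_def by blast
  next
    fix y assume y: "y \<in> nonfixed_component G x"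
    have xG: "x < G x" using m by simp
    have up: "\<exists>l. y < int_iter G l x"
    proof (cases "x \<le> y")
      case True
      then have "\<And>z. z \<in> {x..y} \<Longrightarrow> G z \<noteq> z" using y by (auto simp: nonfixed_component_def)
      from iterates_exceed[OF cont mono xG this] show ?thesis by (metis int_iter_of_nat)
    next
      case False
      then show ?thesis by (intro exI[of _ 0]) simp
    qed
    have down: "\<exists>l. int_iter G l x \<le> y"
    proof (cases "y \<le> x")
      case True
      then have "\<And>z. z \<in> {y..x} \<Longrightarrow> G z \<noteq> z" using y by (auto simp: nonfixed_component_def)
      from inverse_iterates_fall_below[OF cont mono bij xG this] show ?thesis
        by (metis int_iter_minus_of_nat)
    next
      case False
      then show ?thesis by (intro exI[of _ 0]) simp
    qed
    obtain l0 l1 where l: "int_iter G l0 x \<le> y" "y < int_iter G l1 x" using up down by auto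
    \<comment> \<open>If no orbit interval contained \<open>y\<close>, induction upwards from
      \<open>l0\<close> would keep all later orbit points at or below \<open>y\<close>,
      contradicting \<open>l1\<close>.\<close>
    have "\<exists>k. int_iter G k x \<le> y \<and> y < int_iter G (k + 1) x"
    proof (rule ccontr)
      assume no: "\<nexists>k. int_iter G k x \<le> y \<and> y < int_iter G (k + 1) x"
      have "int_iter G k x \<le> y" if "l0 \<le> k" for k
        using that
      proof (induction k rule: int_ge_induct)
        case base
        show ?case using l by simp
      next
        case (step i)
        then show ?case using no by (metis not_less)
      qed
      then have "l1 < l0" using l by (meson not_le)
      then have "int_iter G l1 x < int_iter G l0 x" by (rule it_x_strict)
      with l show False by simp
    qed
    then obtain k where k: "int_iter G k x \<le> y" "y < int_iter G (k + 1) x" by auto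
    \<comment> \<open>Pulling \<open>y\<close> back by the \<open>k\<close>-th iterate lands in the
      fundamental domain, where \<open>p\<close> is onto.\<close>
    obtain z where z: "y = int_iter G k z"
      using int_iter_strict_mono_surj[OF bij mono, of k] by (metis surjD)
    have "x \<le> z" "z < G x"
      using k it_less unfolding z int_iter_commute[OF bij, symmetric] by (auto simp: not_less[symmetric])
    then obtain r where r: "0 \<le> r" "r < 1" "p r = z" using p_surj by auto
    have "\<lfloor>of_int k + r\<rfloor> = k" using r by linarith
    then have "\<beta> (of_int k + r) = y" using r z by (simp add: \<beta>_def frac_def)
    then show "y \<in> range \<beta>" by auto
  qed
  ultimately show ?thesis using that by blast
qed

section \<open>Square roots on a single component of the non-fixed set\<close>

lemma nonfixed_component_root_above:
  fixes G :: "real \<Rightarrow> real"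
  assumes "continuous_on UNIV G" and "strict_mono G" and "bij G" and "x < m" "m < G x"
  shows "\<exists>\<phi>. strict_mono_on (nonfixed_component G x) \<phi> \<and>
    \<phi> ` nonfixed_component G x \<subseteq> nonfixed_component G x \<and>
    (\<forall>y\<in>nonfixed_component G x. \<phi> (\<phi> y) = G y) \<and> \<phi> x = m"
proof -
  obtain \<beta> :: "real \<Rightarrow> real" where b: "strict_mono \<beta>" "range \<beta> = nonfixed_component G x"
    "\<And>s. \<beta> (s + 1) = G (\<beta> s)" "\<beta> 0 = x" "\<beta> (1 / 2) = m"
    using abel_parametrization[OF assms] by blast
  \<comment> \<open>Since \<^term>\<open>\<beta>\<close> conjugates translation by 1 to \<^term>\<open>G\<close>, translation by 1/2 gives a square root.\<close>
  define \<phi> where "\<phi> y = \<beta> (inv \<beta> y + 1 / 2)" for y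
  have *: "\<phi> (\<beta> s) = \<beta> (s + 1 / 2)" for s
    using b(1) by (simp add: \<phi>_def strict_mono_on_imp_inj_on)
  show ?thesis
    unfolding b(2)[symmetric]
  proof (intro exI[of _ \<phi>] conjI)
    show "strict_mono_on (range \<beta>) \<phi>"
      by (auto simp: * monotone_on_def strict_mono_less[OF b(1)])
    show "\<phi> ` range \<beta> \<subseteq> range \<beta>" by (auto simp: *)
    show "\<forall>y\<in>range \<beta>. \<phi> (\<phi> y) = G y" by (auto simp: * add.assoc b(3))
    show "\<phi> x = m" using *[of 0] b(4,5) by simp
  qed
qed

lemma nonfixed_component_root:
  fixes G :: "real \<Rightarrow> real"
  assumes cont: "continuous_on UNIV G" and mono: "strict_mono G" and bij: "bij G"
    and m: "x < m \<and> m < G x \<or> G x < m \<and> m < x"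
  shows "\<exists>\<phi>. strict_mono_on (nonfixed_component G x) \<phi> \<and>
    \<phi> ` nonfixed_component G x \<subseteq> nonfixed_component G x \<and>
    (\<forall>y\<in>nonfixed_component G x. \<phi> (\<phi> y) = G y) \<and> \<phi> x = m"
  using m
proof
  assume "x < m \<and> m < G x"
  then show ?thesis using nonfixed_component_root_above[OF cont mono bij] by blast
next
  assume m: "G x < m \<and> m < x"
  \<comment> \<open>Conjugation by negation turns a map that moves \<open>x\<close> down into one
    that moves \<open>- x\<close> up; it carries components to components.\<close>
  define G' where "G' y = - G (- y)" for y
  have C: "y \<in> nonfixed_component G' (- x) \<longleftrightarrow> - y \<in> nonfixed_component G x" for y
  proof -
    have "z \<in> {min (- x) y..max (- x) y} \<longleftrightarrow> - z \<in> {min x (- y)..max x (- y)}" for z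
      by (auto simp: min_def max_def)
    then have *: "(\<forall>z\<in>{min (- x) y..max (- x) y}. P (- z)) \<longleftrightarrow> (\<forall>z\<in>{min x (- y)..max x (- y)}. P z)"
      for P :: "real \<Rightarrow> bool"
      by (metis (no_types) minus_minus)
    have "(- G (- z) \<noteq> z) \<longleftrightarrow> (G (- z) \<noteq> - z)" for z by auto
    then show ?thesis
      using *[of "\<lambda>z. G z \<noteq> z"] by (simp add: nonfixed_component_def G'_def)
  qed
  have "bij G'"
  proof (rule o_bij)
    show "(\<lambda>y. - inv G (- y)) \<circ> G' = id" using bij by (auto simp: G'_def bij_is_inj)
    show "G' \<circ> (\<lambda>y. - inv G (- y)) = id" using bij by (auto simp: G'_def bij_is_surj surj_f_inv_f)
  qed
  moreover have "strict_mono G'" using mono by (simp add: G'_def strict_mono_def)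
  moreover have "continuous_on UNIV G'" unfolding G'_def
    by (intro continuous_intros continuous_on_compose2[OF cont]) auto
  moreover have "- x < - m" "- m < G' (- x)" using m by (auto simp: G'_def)
  ultimately obtain \<phi> where \<phi>: "strict_mono_on (nonfixed_component G' (- x)) \<phi>"
    "\<phi> ` nonfixed_component G' (- x) \<subseteq> nonfixed_component G' (- x)"
    "\<forall>y\<in>nonfixed_component G' (- x). \<phi> (\<phi> y) = G' y" "\<phi> (- x) = - m"
    using nonfixed_component_root_above[of G' "- x" "- m"] by auto
  show ?thesis
  proof (intro exI[of _ "\<lambda>y. - \<phi> (- y)"] conjI)
    show "strict_mono_on (nonfixed_component G x) (\<lambda>y. - \<phi> (- y))"
      using \<phi>(1) by (auto simp: monotone_on_def C)
    show "(\<lambda>y. - \<phi> (- y)) ` nonfixed_component G x \<subseteq> nonfixed_component G x"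
      using \<phi>(2) C by (auto simp: image_subset_iff)
    show "\<forall>y\<in>nonfixed_component G x. - \<phi> (- (- \<phi> (- y))) = G y"
      using \<phi>(3) by (auto simp: C G'_def)
    show "- \<phi> (- x) = m" using \<phi>(4) by simp
  qed
qed

text \<open>Of three points on the line, the segment joining any two is covered by the segments to
  the third. Thus components do not depend on the base point, and roots can be chosen per
  component.\<close>

lemma nonfixed_component_eq:
  assumes "y \<in> nonfixed_component G x"
  shows "nonfixed_component G y = nonfixed_component G x"
proof -
  have "z \<in> {min x w..max x w} \<Longrightarrow> z \<in> {min x y..max x y} \<or> z \<in> {min y w..max y w}"
    "z \<in> {min y w..max y w} \<Longrightarrow> z \<in> {min x y..max x y} \<or> z \<in> {min x w..max x w}" for z w :: real
    by (auto simp: min_def max_def split: if_splits)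
  then show ?thesis using assms unfolding nonfixed_component_def by blast
qed

text \<open>Roots on distinct components do not interact, since each preserves its component and
  fixed points separate them. \<open>q\<close> prescribes the root on \<open>S\<close>; one value
  per component can be prescribed freely, whence the condition that \<open>S\<close> meets each
  component at most once.\<close>

lemma iterative_root_real_line:
  fixes G q :: "real \<Rightarrow> real"
  assumes cont: "continuous_on UNIV G" and mono: "strict_mono G" and bij: "bij G"
    and q: "\<And>x. x \<in> S \<Longrightarrow> x < q x \<and> q x < G x \<or> G x < q x \<and> q x < x"
    and S: "\<And>x y. x \<in> S \<Longrightarrow> y \<in> S \<Longrightarrow> y \<in> nonfixed_component G x \<Longrightarrow> x = y"
  obtains \<Phi> where "strict_mono \<Phi>" "\<And>x. \<Phi> (\<Phi> x) = G x" "\<And>x. G x = x \<Longrightarrow> \<Phi> x = x"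
    "\<And>x. x \<in> S \<Longrightarrow> \<Phi> x = q x"
proof -
  define good where "good C \<phi> \<longleftrightarrow> strict_mono_on C \<phi> \<and> \<phi> ` C \<subseteq> C \<and> (\<forall>y\<in>C. \<phi> (\<phi> y) = G y) \<and>
    (\<forall>x\<in>S \<inter> C. \<phi> x = q x)" for C and \<phi> :: "real \<Rightarrow> real"
  let ?C = "nonfixed_component G"
  have self: "x \<in> ?C x \<longleftrightarrow> G x \<noteq> x" for x by (auto simp: nonfixed_component_def)
  have ex: "\<exists>\<phi>. good (?C x) \<phi>" if "G x \<noteq> x" for x
  proof (cases "S \<inter> ?C x = {}")
    case True
    \<comment> \<open>Nothing is prescribed on this component, so any value strictly between
      \<open>x\<close> and \<open>G x\<close> serves; the midpoint is taken.\<close>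
    define m where "m = (x + G x) / 2"
    have "x < m \<and> m < G x \<or> G x < m \<and> m < x" using that by (auto simp: m_def field_simps)
    from nonfixed_component_root[OF cont mono bij this] show ?thesis
      using True by (auto simp: good_def)
  next
    case False
    then obtain y where y: "y \<in> S" "y \<in> ?C x" by auto
    have eq: "?C y = ?C x" by (rule nonfixed_component_eq[OF y(2)])
    have "S \<inter> ?C x = {y}" using S[OF y(1)] y unfolding eq by blast
    then show ?thesis
      using nonfixed_component_root[OF cont mono bij q[OF y(1)]] unfolding good_def eq by simp
  qed
  \<comment> \<open>The choice depends on the component as a set, so all its points share one
    root.\<close>
  define \<phi> where "\<phi> C = (SOME \<phi>. good C \<phi>)" for C
  have good: "good (?C x) (\<phi> (?C x))" if "G x \<noteq> x" for x
    unfolding \<phi>_def by (rule someI_ex[OF ex[OF that]])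
  define \<Phi> where "\<Phi> x = (if G x = x then x else \<phi> (?C x) x)" for x
  have mem: "\<Phi> x \<in> ?C x" if "G x \<noteq> x" for x
    using good[OF that] that self[of x] by (auto simp: \<Phi>_def good_def)
  have eqC: "?C y = ?C x" "G y \<noteq> y" if "y \<in> ?C x" for x y
    using nonfixed_component_eq[OF that] that by (auto simp: nonfixed_component_def)
  \<comment> \<open>A fixed point is a barrier: the image of a non-fixed point stays in its
    component, which contains no point beyond \<open>z\<close>.\<close>
  have below: "\<Phi> x \<le> z" "x \<noteq> z \<Longrightarrow> \<Phi> x < z" if "x \<le> z" "G z = z" for x z
  proof -
    have "\<Phi> x < z" if ne: "x \<noteq> z"
    proof (rule ccontr)
      assume "\<not> \<Phi> x < z"
      moreover from this have "G x \<noteq> x" using \<open>x \<le> z\<close> ne by (auto simp: \<Phi>_def)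
      ultimately show False using mem[of x] \<open>x \<le> z\<close> \<open>G z = z\<close> by (force simp: nonfixed_component_def)
    qed
    then show "\<Phi> x \<le> z" "x \<noteq> z \<Longrightarrow> \<Phi> x < z"
      using that by (cases "x = z"; force simp: \<Phi>_def)+
  qed
  have above: "z \<le> \<Phi> x" "x \<noteq> z \<Longrightarrow> z < \<Phi> x" if "z \<le> x" "G z = z" for x z
  proof -
    have "z < \<Phi> x" if ne: "x \<noteq> z"
    proof (rule ccontr)
      assume "\<not> z < \<Phi> x"
      moreover from this have "G x \<noteq> x" using \<open>z \<le> x\<close> ne by (auto simp: \<Phi>_def)
      ultimately show False using mem[of x] \<open>z \<le> x\<close> \<open>G z = z\<close> by (force simp: nonfixed_component_def)
    qed
    then show "z \<le> \<Phi> x" "x \<noteq> z \<Longrightarrow> z < \<Phi> x"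
      using that by (cases "x = z"; force simp: \<Phi>_def)+
  qed
  have "\<Phi> x < \<Phi> y" if "x < y" for x y
  proof (cases "y \<in> ?C x")
    case True
    have "x \<in> ?C x" using True by (auto simp: nonfixed_component_def)
    then have "\<phi> (?C x) x < \<phi> (?C x) y"
      using good[of x] True that self[of x] by (auto simp: good_def monotone_on_def)
    then show ?thesis using eqC[OF True] \<open>x \<in> ?C x\<close> self[of x] by (simp add: \<Phi>_def)
  next
    case False
    then obtain z where "z \<in> {min x y..max x y}" and fixed: "G z = z"
      unfolding nonfixed_component_def by blast
    then have z: "x \<le> z" "z \<le> y" "G z = z" using that by auto
    show ?thesis using below[of x z] above[of z y] z that by fastforce
  qed
  then have "strict_mono \<Phi>" by (simp add: strict_mono_def)
  moreover have "\<Phi> (\<Phi> x) = G x" for x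
  proof (cases "G x = x")
    case True
    then show ?thesis by (simp add: \<Phi>_def)
  next
    case False
    then have "\<Phi> (\<Phi> x) = \<phi> (?C x) (\<phi> (?C x) x)"
      using eqC[OF mem[OF False]] by (simp add: \<Phi>_def)
    then show ?thesis using good[OF False] False self[of x] by (simp add: good_def)
  qed
  moreover have "\<Phi> x = q x" if "x \<in> S" for x
  proof -
    have "G x \<noteq> x" using q[OF that] by auto
    then show ?thesis using good[of x] that self[of x] by (auto simp: \<Phi>_def good_def)
  qed
  moreover have "\<Phi> x = x" if "G x = x" for x using that by (simp add: \<Phi>_def)
  ultimately show ?thesis using that by blast
qed

text \<open>A jump of \<^term>\<open>\<Phi>\<close> at a point would survive in the composition \<^term>\<open>\<Phi> \<circ> \<Phi>\<close>.\<close>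

lemma strict_mono_root_continuous:
  fixes \<Phi> G :: "real \<Rightarrow> real"
  assumes cont: "continuous_on UNIV G" and mono: "strict_mono \<Phi>" and root: "\<And>x. \<Phi> (\<Phi> x) = G x"
  shows "continuous_on UNIV \<Phi>"
proof -
  have "(\<Phi> \<longlongrightarrow> \<Phi> x) (at x)" for x
  proof (rule order_tendstoI)
    fix l assume l: "l < \<Phi> x"
    \<comment> \<open>Otherwise \<open>G y \<le> \<Phi> l < G x\<close> for all
      \<open>y < x\<close>, against left continuity of \<open>G\<close> at \<open>x\<close>.\<close>
    have "\<exists>y<x. l < \<Phi> y"
    proof (rule ccontr)
      assume "\<not> (\<exists>y<x. l < \<Phi> y)"
      then have *: "G y \<le> \<Phi> l" if "y < x" for y
        using that mono by (metis not_less root strict_mono_less)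
      have "\<Phi> l < G x" using l mono by (metis root strict_mono_less)
      moreover have "(G \<longlongrightarrow> G x) (at_left x)"
        using cont by (meson UNIV_I continuous_on_def filterlim_within_subset subset_UNIV)
      ultimately have "eventually (\<lambda>y. \<Phi> l < G y) (at_left x)" by (rule order_tendstoD(1)[rotated])
      moreover have "eventually (\<lambda>y. y < x) (at_left x)" by (simp add: eventually_at_filter)
      ultimately have "eventually (\<lambda>y. False) (at_left x)"
        by eventually_elim (use * in force)
      then show False by simp
    qed
    then obtain y where y: "y < x" "l < \<Phi> y" by blast
    have "eventually (\<lambda>z. y < z) (at x)" using y(1) by (rule order_tendstoD(1)[OF tendsto_ident_at])
    then show "eventually (\<lambda>z. l < \<Phi> z) (at x)"
      by eventually_elim (use y(2) mono in \<open>metis order_less_trans strict_mono_less\<close>)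
  next
    fix l assume l: "\<Phi> x < l"
    have "\<exists>y>x. \<Phi> y < l"
    proof (rule ccontr)
      assume "\<not> (\<exists>y>x. \<Phi> y < l)"
      then have *: "\<Phi> l \<le> G y" if "x < y" for y
        using that mono by (metis not_less root strict_mono_less)
      have "G x < \<Phi> l" using l mono by (metis root strict_mono_less)
      moreover have "(G \<longlongrightarrow> G x) (at_right x)"
        using cont by (meson UNIV_I continuous_on_def filterlim_within_subset subset_UNIV)
      ultimately have "eventually (\<lambda>y. G y < \<Phi> l) (at_right x)" by (rule order_tendstoD(2)[rotated])
      moreover have "eventually (\<lambda>y. x < y) (at_right x)" by (simp add: eventually_at_filter)
      ultimately have "eventually (\<lambda>y. False) (at_right x)"
        by eventually_elim (use * in force)
      then show False by simp
    qed
    then obtain y where y: "x < y" "\<Phi> y < l" by blast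
    have "eventually (\<lambda>z. z < y) (at x)" using y(1) by (rule order_tendstoD(2)[OF tendsto_ident_at])
    then show "eventually (\<lambda>z. \<Phi> z < l) (at x)"
      by eventually_elim (use y(2) mono in \<open>metis order_less_trans strict_mono_less\<close>)
  qed
  then show ?thesis by (simp add: continuous_on_def)
qed

text \<open>Translations extend \<open>F\<close> to a homeomorphism of the line, and
  \<open>e\<close> and \<open>d\<close> become values prescribed at \<open>p\<close> and
  \<open>q\<close>. A fixed endpoint is fixed by the root anyway.\<close>

lemma iterative_root_interval:
  fixes F :: "real \<Rightarrow> real"
  assumes pq: "p < q" and cont: "continuous_on {p..q} F" and mono: "strict_mono_on {p..q} F"
    and e: "e = p \<and> F p = p \<or> p < e \<and> e < F p" and d: "d = q \<and> F q = q \<or> F q < d \<and> d < q"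
  obtains \<phi> where "continuous_on {p..q} \<phi>" "strict_mono_on {p..q} \<phi>"
    "\<And>x. x \<in> {p..q} \<Longrightarrow> \<phi> (\<phi> x) = F x" "\<phi> p = e" "\<phi> q = d"
proof -
  define G where "G x = F (max p (min q x)) + (x - max p (min q x))" for x
  have GF: "G x = F x" if "x \<in> {p..q}" for x using that by (simp add: G_def)
  have Glo: "G x = F p + (x - p)" if "x \<le> p" for x using that pq by (auto simp: G_def max_def min_def)
  have Ghi: "G x = F q + (x - q)" if "x \<ge> q" for x using that pq by (auto simp: G_def max_def min_def)
  have contG: "continuous_on UNIV G" unfolding G_def
    by (intro continuous_intros continuous_on_compose2[OF cont]) (use pq in auto)
  have monoG: "strict_mono G"
  proof (rule strict_monoI)
    fix x y :: real assume xy: "x < y"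
    show "G x < G y"
    proof (cases "max p (min q x) = max p (min q y)")
      case True
      then show ?thesis using xy by (simp add: G_def)
    next
      case False
      then have "max p (min q x) < max p (min q y)"
        and "x - max p (min q x) \<le> y - max p (min q y)"
        using xy pq by (auto simp: max_def min_def split: if_splits)
      moreover have "F (max p (min q x)) < F (max p (min q y))"
        using calculation(1) pq by (intro strict_mono_onD[OF mono]) auto
      ultimately show ?thesis unfolding G_def by linarith
    qed
  qed
  have "surj G"
  proof (rule surjI)
    have "\<exists>x. G x = y" for y
    proof -
      consider "y \<le> F p" | "F p \<le> y" "y \<le> F q" | "F q \<le> y" by linarith
      then show ?thesis
      proof cases
        case 1
        then show ?thesis by (intro exI[of _ "p + (y - F p)"]) (simp add: Glo)
      next
        case 2
        then obtain x where "p \<le> x" "x \<le> q" "F x = y" using IVT'[of F p y q] pq cont by auto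
        then show ?thesis using GF by auto
      next
        case 3
        then show ?thesis by (intro exI[of _ "q + (y - F q)"]) (simp add: Ghi)
      qed
    qed
    then show "G (SOME x. G x = y) = y" for y by (metis (mono_tags) someI_ex)
  qed
  then have bijG: "bij G" using monoG by (simp add: bij_def strict_mono_on_imp_inj_on)
  \<comment> \<open>Only endpoints that \<open>F\<close> moves need a prescribed value;
    \<open>r\<close> supplies it.\<close>
  define S where "S = {x \<in> {p, q}. F x \<noteq> x}"
  define r where "r x = (if x = p then e else d)" for x
  have Gpq: "G p = F p" "G q = F q" using pq by (auto intro: GF)
  have r: "x < r x \<and> r x < G x \<or> G x < r x \<and> r x < x" if "x \<in> S" for x
    using that e d pq by (auto simp: S_def r_def Gpq)
  have S: "x = y" if xy: "x \<in> S" "y \<in> S" "y \<in> nonfixed_component G x" for x y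
  proof (rule ccontr)
    assume ne: "x \<noteq> y"
    \<comment> \<open>When both endpoints move, they move inwards, so the intermediate value theorem
      puts a fixed point between them and they lie in different components.\<close>
    then have "F p > p" "F q < q" using xy e d by (auto simp: S_def)
    then obtain z where "p \<le> z" "z \<le> q" "F z - z = 0"
      using IVT2'[of "\<lambda>z. F z - z" q 0 p] pq continuous_on_diff[OF cont continuous_on_id] by auto
    then have "z \<in> {min x y..max x y}" "G z = z" using ne xy GF[of z] pq by (auto simp: S_def)
    then show False using xy(3) by (auto simp: nonfixed_component_def simp del: atLeastAtMost_iff)
  qed
  obtain \<Phi> where \<Phi>: "strict_mono \<Phi>" "\<And>x. \<Phi> (\<Phi> x) = G x" "\<And>x. G x = x \<Longrightarrow> \<Phi> x = x"
    "\<And>x. x \<in> S \<Longrightarrow> \<Phi> x = r x"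
    using iterative_root_real_line[OF contG monoG bijG r S] by blast
  have "continuous_on {p..q} \<Phi>"
    using strict_mono_root_continuous[OF contG \<Phi>(1,2)] continuous_on_subset by blast
  moreover have "strict_mono_on {p..q} \<Phi>" using \<Phi>(1) by (auto simp: monotone_on_def)
  moreover have "\<Phi> p = e"
    using \<Phi>(3)[of p] \<Phi>(4)[of p] e by (cases "F p = p") (auto simp: S_def r_def Gpq)
  moreover have "\<Phi> q = d"
    using \<Phi>(3)[of q] \<Phi>(4)[of q] d pq by (cases "F q = q") (auto simp: S_def r_def Gpq)
  ultimately show ?thesis using that \<Phi>(2) GF by metis
qed

section \<open>Forts and strict monotonicity\<close>

lemma increasing_inverse:
  fixes f :: "real \<Rightarrow> real"
  assumes xy: "x \<le> y" and cont: "continuous_on {x..y} f" and mono: "strict_mono_on {x..y} f"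
  obtains g where "continuous_on {f x..f y} g" "strict_mono_on {f x..f y} g"
    "\<And>s. s \<in> {f x..f y} \<Longrightarrow> g s \<in> {x..y} \<and> f (g s) = s"
    "\<And>t. t \<in> {x..y} \<Longrightarrow> g (f t) = t"
proof -
  have inj: "inj_on f {x..y}" using mono by (rule strict_mono_on_imp_inj_on)
  have img: "f ` {x..y} = {f x..f y}"
  proof
    show "f ` {x..y} \<subseteq> {f x..f y}"
      using xy strict_mono_on_leD[OF mono] by auto
    show "{f x..f y} \<subseteq> f ` {x..y}"
      using IVT'[of f x _ y] xy cont by fastforce
  qed
  define g where "g = the_inv_into {x..y} f"
  have g: "g s \<in> {x..y} \<and> f (g s) = s" if "s \<in> {f x..f y}" for s
    using that inj unfolding g_def img[symmetric]
    by (simp add: f_the_inv_into_f the_inv_into_into del: atLeastAtMost_iff)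
  have gf: "g (f t) = t" if "t \<in> {x..y}" for t using that inj by (simp add: g_def the_inv_into_f_f)
  have "continuous_on {f x..f y} g"
    unfolding g_def img[symmetric] using cont compact_Icc inj by (rule continuous_on_inv_into)
  moreover have "strict_mono_on {f x..f y} g"
  proof (rule strict_mono_onI)
    fix s t assume st: "s \<in> {f x..f y}" "t \<in> {f x..f y}" "s < t"
    show "g s < g t"
    proof (rule ccontr)
      assume "\<not> g s < g t"
      then have "f (g t) \<le> f (g s)" using g st by (intro strict_mono_on_leD[OF mono]) auto
      then show False using g st by auto
    qed
  qed
  ultimately show ?thesis using that g gf by blast
qed

lemma decreasing_inverse:
  fixes f :: "real \<Rightarrow> real"
  assumes xy: "x \<le> y" and cont: "continuous_on {x..y} f" and mono: "strict_antimono_on {x..y} f"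
  obtains g where "continuous_on {f y..f x} g" "strict_antimono_on {f y..f x} g"
    "\<And>s. s \<in> {f y..f x} \<Longrightarrow> g s \<in> {x..y} \<and> f (g s) = s"
    "\<And>t. t \<in> {x..y} \<Longrightarrow> g (f t) = t"
proof -
  have "continuous_on {x..y} (\<lambda>t. - f t)" using cont by (intro continuous_intros)
  moreover have "strict_mono_on {x..y} (\<lambda>t. - f t)" using mono by (auto simp: monotone_on_def)
  ultimately obtain g where g: "continuous_on {- f x..- f y} g" "strict_mono_on {- f x..- f y} g"
    "\<And>s. s \<in> {- f x..- f y} \<Longrightarrow> g s \<in> {x..y} \<and> - f (g s) = s"
    "\<And>t. t \<in> {x..y} \<Longrightarrow> g (- f t) = t"
    using increasing_inverse[OF xy] by blast
  show ?thesis
  proof (rule that[of "\<lambda>s. g (- s)"])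
    show "continuous_on {f y..f x} (\<lambda>s. g (- s))"
      by (intro continuous_on_compose2[OF g(1)] continuous_intros) auto
    show "strict_antimono_on {f y..f x} (\<lambda>s. g (- s))"
      using g(2) by (auto simp: monotone_on_def)
    show "g (- s) \<in> {x..y} \<and> f (g (- s)) = s" if "s \<in> {f y..f x}" for s
      using g(3)[of "- s"] that by auto
    show "g (- f t) = t" if "t \<in> {x..y}" for t using g(4) that .
  qed
qed

section \<open>Strict monotonicity under composition, and extrema as forts\<close>

lemma strictly_monotone_on_subset:
  "strictly_monotone_on S F \<Longrightarrow> T \<subseteq> S \<Longrightarrow> strictly_monotone_on T F"
  unfolding strictly_monotone_on_def by (meson monotone_on_subset)

lemma strictly_monotone_on_compose:
  assumes "strictly_monotone_on (F ` S) h"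
  shows "strictly_monotone_on S (\<lambda>x. h (F x)) \<longleftrightarrow> strictly_monotone_on S F"
proof -
  consider "\<And>x y. x \<in> S \<Longrightarrow> y \<in> S \<Longrightarrow> F x < F y \<longleftrightarrow> h (F x) < h (F y)"
    | "\<And>x y. x \<in> S \<Longrightarrow> y \<in> S \<Longrightarrow> F x < F y \<longleftrightarrow> h (F y) < h (F x)"
  proof -
    have "(\<forall>u\<in>F ` S. \<forall>v\<in>F ` S. u < v \<longleftrightarrow> h u < h v) \<or> (\<forall>u\<in>F ` S. \<forall>v\<in>F ` S. u < v \<longleftrightarrow> h v < h u)"
      using assms unfolding strictly_monotone_on_def monotone_on_def
      by (metis linorder_neqE_linordered_idom order_less_asym' order_less_irrefl)
    then show ?thesis using that by blast
  qed
  then show ?thesis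
    by cases (auto simp: strictly_monotone_on_def monotone_on_def)
qed

lemma extremum_in_forts:
  assumes "s < z" "z < t" "{s..t} \<subseteq> {a..b}"
    and ext: "(\<forall>x\<in>{s..t}. F x \<le> F z) \<or> (\<forall>x\<in>{s..t}. F z \<le> F x)"
  shows "z \<in> forts a b F"
proof -
  have False if U: "open U" "z \<in> U" "strictly_monotone_on (U \<inter> {a..b}) F" for U
  proof -
    obtain \<epsilon> where \<epsilon>: "\<epsilon> > 0" "ball z \<epsilon> \<subseteq> U" using U openE by blast
    \<comment> \<open>Halving \<open>\<epsilon>\<close> keeps both points at distance
      \<open>\<delta>\<close> inside the open ball; the other bounds keep them in
      \<open>[s, t]\<close>.\<close>
    define \<delta> where "\<delta> = min (\<epsilon> / 2) (min (z - s) (t - z))"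
    have \<delta>: "\<delta> > 0" "\<delta> < \<epsilon>" "s \<le> z - \<delta>" "z + \<delta> \<le> t" using assms \<epsilon> by (auto simp: \<delta>_def min_def)
    have mem: "z - \<delta> \<in> U \<inter> {a..b}" "z + \<delta> \<in> U \<inter> {a..b}" "z \<in> U \<inter> {a..b}"
      using \<delta> \<epsilon> assms U by (auto simp: subset_eq dist_real_def)
    have "z - \<delta> < z" "z < z + \<delta>" using \<delta> by auto
    then have "F (z - \<delta>) < F z \<and> F z < F (z + \<delta>) \<or> F z < F (z - \<delta>) \<and> F (z + \<delta>) < F z"
      using U(3) mem unfolding strictly_monotone_on_def monotone_on_def by blast
    moreover have "z - \<delta> \<in> {s..t}" "z + \<delta> \<in> {s..t}" using \<delta> by auto
    ultimately show False using ext by force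
  qed
  moreover have "s \<in> {a..b}" "t \<in> {a..b}" using assms by auto
  ultimately show ?thesis using assms unfolding forts_def by auto
qed

text \<open>A continuous injective map takes interior points to values strictly between the endpoint
  values. This is used on \<open>[x, y]\<close> for \<open>t\<close>, then on \<open>[x, t]\<close>
  for \<open>s\<close>.\<close>

lemma inj_imp_strict_mono_on:
  fixes F :: "real \<Rightarrow> real"
  assumes cont: "continuous_on {x..y} F" and inj: "inj_on F {x..y}" and less: "F x < F y"
  shows "strict_mono_on {x..y} F"
proof (rule strict_mono_onI)
  fix s t assume st: "s \<in> {x..y}" "t \<in> {x..y}" "s < t"
  have xt: "F x < F t"
    using continuous_inj_imp_mono[OF _ _ cont inj, of t] less st by (cases "t = y") auto
  have "continuous_on {x..t} F" "inj_on F {x..t}"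
    using cont inj st by (auto intro: continuous_on_subset inj_on_subset)
  from continuous_inj_imp_mono[OF _ _ this, of s] show "F s < F t"
    using st xt by (cases "s = x") auto
qed

text \<open>Interior extrema are forts, so without forts no value is taken twice; a continuous
  injective map on an interval is strictly monotone.\<close>

lemma strictly_monotone_between_forts:
  fixes F :: "real \<Rightarrow> real"
  assumes cont: "continuous_on {a..b} F" and xy: "x < y" "{x..y} \<subseteq> {a..b}"
    and nofort: "{x<..<y} \<inter> forts a b F = {}"
  shows "strictly_monotone_on {x..y} F"
proof -
  have noext: False if "s < z" "z < t" "s \<in> {x..y}" "t \<in> {x..y}"
    "(\<forall>w\<in>{s..t}. F w \<le> F z) \<or> (\<forall>w\<in>{s..t}. F z \<le> F w)" for s z t
  proof -
    have "{s..t} \<subseteq> {x..y}" using that by auto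
    then have "z \<in> forts a b F" using that xy by (intro extremum_in_forts[of s z t]) auto
    moreover have "z \<in> {x<..<y}" using that by auto
    ultimately show False using nofort by blast
  qed
  have "inj_on F {x..y}"
  proof (rule linorder_inj_onI')
    fix s t assume st: "s \<in> {x..y}" "t \<in> {x..y}" "s < t"
    have sub: "{s..t} \<subseteq> {a..b}" using st xy by auto
    have cst: "continuous_on {s..t} F" using cont sub by (rule continuous_on_subset)
    obtain zM where zM: "zM \<in> {s..t}" "\<forall>w\<in>{s..t}. F w \<le> F zM"
      using continuous_attains_sup[OF compact_Icc _ cst] st by force
    obtain zm where zm: "zm \<in> {s..t}" "\<forall>w\<in>{s..t}. F zm \<le> F w"
      using continuous_attains_inf[OF compact_Icc _ cst] st by force
    show "F s \<noteq> F t"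
    proof
      assume eq: "F s = F t"
      \<comment> \<open>With both extrema at the endpoints and equal endpoint values,
        \<open>F\<close> is constant on \<open>[s, t]\<close>, and then the midpoint is an interior
        extremum.\<close>
      have "zM = s \<or> zM = t" using noext[of s zM t] st zM by force
      moreover have "zm = s \<or> zm = t" using noext[of s zm t] st zm by force
      ultimately have "F zM = F s" "F zm = F s" using eq by auto
      then have "F s \<le> F ((s + t) / 2)" "\<forall>w\<in>{s..t}. F w \<le> F s" using zM zm st by auto
      then have "\<forall>w\<in>{s..t}. F w \<le> F ((s + t) / 2)" using order_trans by blast
      then show False using noext[of s "(s + t) / 2" t] st by auto
    qed
  qed
  moreover have "continuous_on {x..y} F" using cont xy(2) by (rule continuous_on_subset)
  moreover have "F x \<noteq> F y" using calculation(1) xy(1) by (auto dest: inj_onD)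
  moreover have "strict_antimono_on {x..y} F" if "F y < F x"
  proof -
    have "strict_mono_on {x..y} (\<lambda>z. - F z)"
      using calculation that
      by (intro inj_imp_strict_mono_on) (auto intro!: continuous_intros simp: inj_on_def)
    then show ?thesis by (auto simp: monotone_on_def)
  qed
  ultimately show ?thesis
    unfolding strictly_monotone_on_def using inj_imp_strict_mono_on by (meson linorder_neqE_linordered_idom)
qed

lemma forts_cong:
  assumes "\<And>x. x \<in> {a..b} \<Longrightarrow> f x = g x"
  shows "forts a b f = forts a b g"
proof -
  have "strictly_monotone_on (U \<inter> {a..b}) f \<longleftrightarrow> strictly_monotone_on (U \<inter> {a..b}) g" for U
    using assms by (auto simp: strictly_monotone_on_def monotone_on_def)
  then show ?thesis by (simp add: forts_def)
qed

lemma forts_compose: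
  assumes "strictly_monotone_on (F ` {a..b}) h"
  shows "forts a b (\<lambda>x. h (F x)) = forts a b F"
proof -
  have "strictly_monotone_on (U \<inter> {a..b}) (\<lambda>x. h (F x)) \<longleftrightarrow> strictly_monotone_on (U \<inter> {a..b}) F" for U
    using assms by (intro strictly_monotone_on_compose strictly_monotone_on_subset[OF assms]) auto
  then show ?thesis by (simp add: forts_def)
qed

lemma forts_id: "forts a b id = {}"
  by (auto simp: forts_def strictly_monotone_on_def monotone_on_def intro!: exI[of _ UNIV])

text \<open>A local form of \<open>forts_compose\<close> for maps defined piecewise: near
  \<open>x\<close> only one branch \<open>h\<close> matters.\<close>

lemma not_fort_compose:
  assumes x: "x \<in> {a<..<b}" "x \<notin> forts a b F" and V: "open V" "x \<in> V"
    and fh: "\<And>y. y \<in> V \<inter> {a..b} \<Longrightarrow> f y = h (F y) \<and> F y \<in> J"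
    and h: "strictly_monotone_on J h"
  shows "x \<notin> forts a b f"
proof -
  obtain U where U: "open U" "x \<in> U" "strictly_monotone_on (U \<inter> {a..b}) F"
    using x by (auto simp: forts_def)
  let ?W = "(U \<inter> V) \<inter> {a..b}"
  have "strictly_monotone_on ?W F" by (rule strictly_monotone_on_subset[OF U(3)]) auto
  moreover have "strictly_monotone_on (F ` ?W) h"
    by (rule strictly_monotone_on_subset[OF h]) (use fh in auto)
  ultimately have "strictly_monotone_on ?W (\<lambda>x. h (F x))" by (simp add: strictly_monotone_on_compose)
  then have "strictly_monotone_on ?W f"
    using fh by (simp add: strictly_monotone_on_def monotone_on_def)
  moreover have "open (U \<inter> V)" "x \<in> U \<inter> V" using U V by auto
  ultimately show ?thesis unfolding forts_def by blast
qed

text \<open>The fort count changes at exponents 0 and 1 and stays the same at 2; the identity has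
  count 0 by \<open>forts_id\<close>.\<close>

lemma height_eq_2:
  assumes "num_forts a b f \<noteq> 0" "num_forts a b f \<noteq> num_forts a b (f ^^ 2)"
    "num_forts a b (f ^^ 2) = num_forts a b (f ^^ 3)"
  shows "height a b f = 2"
proof -
  let ?P = "\<lambda>i. num_forts a b (f ^^ i) = num_forts a b (f ^^ Suc i)"
  have "?P 2" using assms(3) by (simp add: numeral_3_eq_3 numeral_2_eq_2)
  moreover have "\<not> ?P 0" "\<not> ?P 1"
    using assms(1,2) by (auto simp: num_forts_def forts_id numeral_2_eq_2)
  ultimately have "(LEAST i. ?P i) = 2"
    by (intro Least_equality) (auto intro: ccontr simp: not_le less_2_cases_iff simp del: funpow.simps)
  then show ?thesis using \<open>?P 2\<close> unfolding height_def
    by (metis numeral_eq_enat)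
qed

section \<open>The root of height two\<close>

theorem theorem2p1:
  fixes a b M :: real and F :: "real \<Rightarrow> real" and c :: "nat \<Rightarrow> real" and v u :: nat
  assumes "a < b"
    and "F \<in> PM a b"
    and "c 0 = a" and "c (v + 1) = b"
    and "strict_mono_on {0..v + 1} c"
    and "forts a b F = c ` {1..v}"
    and "height a b F = 1"
    and "is_characteristic_interval a b F {c 0..c 1}"
    and "strict_mono_on {c 0..c 1} F"
    and "u \<in> {4..v + 1}" and "F (c u) = c 0"
    and "\<And>j. j \<in> {4..v + 1} \<Longrightarrow> F (c j) = c 0 \<Longrightarrow> c u \<le> c j"
    and "is_maximum_on {c 0..c u} F (F (c 3))"
    and "is_maximum_on {a..b} F M"
    and "(F (c 2) = c 0 \<and> c 0 = F (c 0) \<and> F (c 1) < F (c 3) \<and> F (c 3) < c 1 \<and> c 1 = M) \<or>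
         (c 0 < F (c 2) \<and> F (c 2) < F (c 0) \<and> F (c 3) = c 1 \<and> c 1 = F (c 1)) \<or>
         (c 0 < F (c 2) \<and> F (c 2) < F (c 0) \<and> F (c 1) < F (c 3) \<and> F (c 3) < c 1)"
  shows "\<exists>f. f \<in> PM a b \<and> (\<forall>x\<in>{a..b}. f (f x) = F x) \<and> height a b f = 2 \<and>
             strict_mono_on {c 0..c 1} f"
proof -

  \<comment> \<open>Order of the forts and strict monotonicity of the laps\<close>
  have contF: "continuous_on {a..b} F" and finF: "finite (forts a b F)"
    using assms(2) by (auto simp: PM_def)
  have rangeF: "F x \<in> {c 0..c 1}" if "x \<in> {a..b}" for x
    using assms(8) that unfolding is_characteristic_interval_def by blast
  have u: "4 \<le> u" "u \<le> v + 1" using assms(10) by auto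
  have c_less: "c i < c j" if "i < j" "j \<le> v + 1" for i j
    using strict_mono_onD[OF assms(5)] that by simp
  have order: "c 0 < c 1" "c 1 < c 2" "c 2 < c 3" "c 3 < c 4" "c 4 \<le> c u" "c u \<le> b" "c 3 < c u"
    using u c_less[of 0 1] c_less[of 1 2] c_less[of 2 3] c_less[of 3 4] c_less[of 4 u] c_less[of u "v + 1"]
      c_less[of 3 u] assms(4) by (auto simp: le_less)
  note [simp] = assms(3)
  have c_fort: "c i \<in> forts a b F" if "1 \<le> i" "i \<le> v" for i using assms(6) that by auto
  have lap: "strictly_monotone_on {c i..c (Suc i)} F" if "i \<le> v" for i
  proof (rule strictly_monotone_between_forts[OF contF])
    show "c i < c (Suc i)" using c_less that by simp
    show "{c i..c (Suc i)} \<subseteq> {a..b}"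
      using c_less[of 0 i] c_less[of "Suc i" "v + 1"] that assms(4)
      by (cases "i = 0"; cases "i = v") auto
    show "{c i<..<c (Suc i)} \<inter> forts a b F = {}"
    proof -
      have "\<not> (c i < c j \<and> c j < c (Suc i))" if "j \<le> v" for j
      proof (cases "j \<le> i")
        case True
        then show ?thesis using c_less[of j i] \<open>i \<le> v\<close> by (cases "j = i") auto
      next
        case False
        then show ?thesis using c_less[of "Suc i" j] that by (cases "j = Suc i") auto
      qed
      then show ?thesis unfolding assms(6) by auto
    qed
  qed

  \<comment> \<open>The square root on the characteristic interval and its extension
    \<open>A\<close>\<close>
  define e where "e = F (c 2)"
  define d where "d = F (c 3)"
  have F01: "F (c 0) < F (c 1)" using order by (intro strict_mono_onD[OF assms(9)]) auto
  \<comment> \<open>Condition (1) fixes the left end and moves the right one, (2) moves the left and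
    fixes the right, (3) moves both.\<close>
  have e: "e = c 0 \<and> F (c 0) = c 0 \<or> c 0 < e \<and> e < F (c 0)" using assms(15) by (auto simp: e_def)
  have d: "d = c 1 \<and> F (c 1) = c 1 \<or> F (c 1) < d \<and> d < c 1" using assms(15) by (auto simp: d_def)
  have "continuous_on {c 0..c 1} F" by (rule continuous_on_subset[OF contF]) (use order in auto)
  then obtain \<phi> where \<phi>: "continuous_on {c 0..c 1} \<phi>" "strict_mono_on {c 0..c 1} \<phi>"
    "\<And>x. x \<in> {c 0..c 1} \<Longrightarrow> \<phi> (\<phi> x) = F x" "\<phi> (c 0) = e" "\<phi> (c 1) = d"
    using iterative_root_interval[OF order(1) _ assms(9) e d] by blast
  obtain \<psi> where \<psi>: "continuous_on {e..d} \<psi>" "strict_mono_on {e..d} \<psi>"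
    "\<And>s. s \<in> {e..d} \<Longrightarrow> \<psi> s \<in> {c 0..c 1} \<and> \<phi> (\<psi> s) = s"
    "\<And>t. t \<in> {c 0..c 1} \<Longrightarrow> \<psi> (\<phi> t) = t"
    using increasing_inverse[OF less_imp_le[OF order(1)] \<phi>(1,2)] unfolding \<phi>(4,5) by blast
  \<comment> \<open>These inequalities orient the next two laps: \<open>F\<close> falls from
    \<open>F (c 1)\<close> to \<open>e\<close>, then rises from \<open>e\<close> to
    \<open>d\<close>.\<close>
  have F1: "e < F (c 1)" "F (c 1) \<le> d" using e d F01 by auto
  have F_le_d: "F x \<le> d" if "x \<in> {c 0..c u}" for x
    using assms(13) that by (simp add: is_maximum_on_def d_def)
  have lap2: "strict_antimono_on {c 1..c 2} F"
  proof -
    have "\<not> strict_mono_on {c 1..c 2} F"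
      using F1 order strict_mono_onD[of "{c 1..c 2}" F "c 1" "c 2"] by (auto simp: e_def)
    then show ?thesis using lap[of 1] u unfolding strictly_monotone_on_def by (simp add: numeral_2_eq_2)
  qed
  have lap3: "strict_mono_on {c 2..c 3} F"
  proof -
    have "\<not> strict_antimono_on {c 2..c 3} F"
      using F1 order monotone_onD[of "{c 2..c 3}" "(<)" "\<lambda>x y. y < x" F "c 2" "c 3"]
      by (auto simp: e_def d_def)
    then show ?thesis using lap[of 2] u unfolding strictly_monotone_on_def by (simp add: numeral_3_eq_3 numeral_2_eq_2)
  qed
  have lap4: "strict_antimono_on {c 3..c 4} F"
  proof -
    have "F (c 4) \<le> F (c 3)" using F_le_d[of "c 4"] order by (auto simp: d_def)
    then have "\<not> strict_mono_on {c 3..c 4} F"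
      using order strict_mono_onD[of "{c 3..c 4}" F "c 3" "c 4"] by auto
    moreover have "Suc 3 = 4" by simp
    ultimately show ?thesis using lap[of 3] u unfolding strictly_monotone_on_def by auto
  qed
  have F_ed: "F x \<in> {e..d}" if x: "x \<in> {c 0..c 3}" for x
  proof -
    consider "x \<in> {c 0..c 1}" | "x \<in> {c 1..c 2}" | "x \<in> {c 2..c 3}"
      using x unfolding atLeastAtMost_iff by linarith
    then have "e \<le> F x"
    proof cases
      case 1
      then have "F (c 0) \<le> F x" using order by (intro strict_mono_on_leD[OF assms(9)]) auto
      then show ?thesis using e by auto
    next
      case 2
      then show ?thesis using monotone_onD[OF lap2, of x "c 2"] order
        by (cases "x = c 2") (auto simp: e_def)
    next
      case 3
      then show ?thesis using strict_mono_onD[OF lap3, of "c 2" x] order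
        by (cases "x = c 2") (auto simp: e_def)
    qed
    then show ?thesis using F_le_d[of x] x order by auto
  qed
  define A where "A x = \<psi> (F x)" for x
  have contA: "continuous_on {c 0..c 3} A" unfolding A_def
    by (intro continuous_on_compose2[OF \<psi>(1)] continuous_on_subset[OF contF]) (use order F_ed in auto)
  have d_mem: "d \<in> {c 0..c 1}" using d e F1 order by auto
  have A_c1: "A (c 1) = d"
    using \<phi>(3)[of "c 1"] \<psi>(4)[OF d_mem] order unfolding A_def \<phi>(5) by simp
  have A_c2: "A (c 2) = c 0" using \<psi>(4)[of "c 0"] order by (simp add: A_def e_def[symmetric] \<phi>(4)[symmetric])
  have A_c3: "A (c 3) = c 1" using \<psi>(4)[of "c 1"] order by (simp add: A_def d_def[symmetric] \<phi>(5)[symmetric])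
  \<comment> \<open>Since \<open>\<phi> (A x) = F x\<close> and \<open>F\<close> is the square of
    \<open>\<phi>\<close> at \<open>A x\<close>, \<open>F (A x) = \<phi> (F x)\<close>; applying
    \<open>\<psi>\<close> gives the claim.\<close>
  have A_root: "A (A x) = F x" if "x \<in> {c 0..c 3}" for x
  proof -
    have Ax: "A x \<in> {c 0..c 1}" "\<phi> (A x) = F x" using \<psi>(3)[OF F_ed[OF that]] by (auto simp: A_def)
    then have "F (A x) = \<phi> (F x)" using \<phi>(3)[of "A x"] by simp
    moreover have "F x \<in> {c 0..c 1}" using that order by (intro rangeF) auto
    ultimately show ?thesis using \<psi>(4) by (simp add: A_def)
  qed
  have A_\<phi>: "A x = \<phi> x" if "x \<in> {c 0..c 1}" for x
  proof -
    have "e \<le> \<phi> x" "\<phi> x \<le> d"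
      using that order strict_mono_on_leD[OF \<phi>(2), of "c 0" x] strict_mono_on_leD[OF \<phi>(2), of x "c 1"]
      unfolding \<phi>(4,5) by auto
    then have "\<phi> x \<in> {c 0..c 1}" using e d_mem by auto
    then show ?thesis using \<psi>(4)[of "\<phi> x"] \<phi>(3)[OF that] unfolding A_def by simp
  qed
  have A12: "strict_antimono_on {c 1..c 2} A"
    unfolding A_def using lap2 \<psi>(2) F_ed order by (auto simp: monotone_on_def)
  have A23: "strict_mono_on {c 2..c 3} A"
    unfolding A_def using lap3 \<psi>(2) F_ed order by (auto simp: monotone_on_def)
  \<comment> \<open>Both branches are right inverses of \<open>A\<close>, so
    \<open>A (h (F x)) = F x\<close>. \<open>h12\<close> accepts values up to \<open>d\<close>,
    which bounds \<open>F\<close> as far as \<open>c u\<close>; beyond, only the bound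
    \<open>c 1\<close> is available and \<open>h23\<close> is used.\<close>
  obtain h12 where h12: "continuous_on {c 0..d} h12" "strict_antimono_on {c 0..d} h12"
    "\<And>s. s \<in> {c 0..d} \<Longrightarrow> h12 s \<in> {c 1..c 2} \<and> A (h12 s) = s"
    "\<And>t. t \<in> {c 1..c 2} \<Longrightarrow> h12 (A t) = t"
    using decreasing_inverse[OF less_imp_le[OF order(2)] continuous_on_subset[OF contA] A12] order
    unfolding A_c1 A_c2 by auto
  obtain h23 where h23: "continuous_on {c 0..c 1} h23" "strict_mono_on {c 0..c 1} h23"
    "\<And>s. s \<in> {c 0..c 1} \<Longrightarrow> h23 s \<in> {c 2..c 3} \<and> A (h23 s) = s"
    "\<And>t. t \<in> {c 2..c 3} \<Longrightarrow> h23 (A t) = t"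
    using increasing_inverse[OF less_imp_le[OF order(3)] continuous_on_subset[OF contA] A23] order
    unfolding A_c2 A_c3 by auto
  have F_0d: "F x \<in> {c 0..d}" if "x \<in> {c 3..c u}" for x
    using that F_le_d[of x] rangeF[of x] order by auto

  \<comment> \<open>The root, its continuity and the root equation\<close>
  define f where "f x = (if x \<le> c 3 then A x else if x \<le> c u then h12 (F x) else h23 (F x))" for x
  have f_left: "f x = A x" if "x \<le> c 3" for x using that by (simp add: f_def)
  \<comment> \<open>The branches agree at both joints: \<open>h12 d = c 1 = A (c 3)\<close>, and
    \<open>F (c u) = c 0\<close> is sent to \<open>c 2\<close> by \<open>h12\<close> and by
    \<open>h23\<close>.\<close>
  have f_mid: "f x = h12 (F x)" if "c 3 \<le> x" "x \<le> c u" for x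
    using that h12(4)[of "c 1"] order A_c1 A_c3 by (cases "x = c 3") (auto simp: f_def d_def)
  have f_right: "f x = h23 (F x)" if "c u \<le> x" for x
    using that h12(4)[of "c 2"] h23(4)[of "c 2"] order A_c2 assms(11) by (cases "x = c u") (auto simp: f_def)
  have contf: "continuous_on {a..b} f"
  proof -
    have "continuous_on {c 0..c 3} f" using contA by (rule continuous_on_eq) (simp add: f_left)
    moreover have "continuous_on {c 3..c u} f"
    proof (rule continuous_on_eq)
      show "continuous_on {c 3..c u} (\<lambda>x. h12 (F x))"
        by (intro continuous_on_compose2[OF h12(1)] continuous_on_subset[OF contF]) (use order F_0d in auto)
    qed (simp add: f_mid)
    moreover have "continuous_on {c u..b} f"
    proof (rule continuous_on_eq)
      show "continuous_on {c u..b} (\<lambda>x. h23 (F x))"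
        by (intro continuous_on_compose2[OF h23(1)] continuous_on_subset[OF contF]) (use order rangeF in auto)
    qed (simp add: f_right)
    ultimately have "continuous_on ({c 0..c 3} \<union> {c 3..c u} \<union> {c u..b}) f"
      by (intro continuous_on_closed_Un closed_Un) auto
    then show ?thesis by (rule continuous_on_subset) auto
  qed
  have f_values: "f x \<in> {c 0..c 3} \<and> A (f x) = F x" if x: "x \<in> {a..b}" for x
  proof -
    consider "x \<in> {c 0..c 3}" | "x \<in> {c 3..c u}" | "x \<in> {c u..b}"
      using x unfolding atLeastAtMost_iff assms(3) by linarith
    then show ?thesis
    proof cases
      case 1
      then show ?thesis using \<psi>(3)[OF F_ed[OF 1]] A_root[OF 1] order by (auto simp: f_left A_def)
    next
      case 2
      then show ?thesis using h12(3)[OF F_0d[OF 2]] order by (auto simp: f_mid)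
    next
      case 3
      then show ?thesis using h23(3)[OF rangeF[OF x]] order by (auto simp: f_right)
    qed
  qed
  \<comment> \<open>The values of \<open>f\<close> lie in \<open>[c 0, c 3]\<close>, where
    \<open>f\<close> is \<open>A\<close>.\<close>
  have f_root: "f (f x) = F x" if "x \<in> {a..b}" for x
    using f_values[OF that] by (simp add: f_left)
  have mono_f: "strict_mono_on {c 0..c 1} f"
    using \<phi>(2) A_\<phi> order by (auto simp: monotone_on_def f_left)

  \<comment> \<open>Forts of the root and its height\<close>
  have c3_fort: "c 3 \<notin> forts a b f"
  proof -
    have left: "f x < f y" if "x < y" "c 2 \<le> x" "y \<le> c 3" for x y
      using strict_mono_onD[OF A23, of x y] that by (simp add: f_left)
    \<comment> \<open>Right of \<open>c 3\<close> both \<open>F\<close> and \<open>h12\<close>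
      decrease, so the peak of \<open>F\<close> at \<open>c 3\<close> becomes a point of increase of
      \<open>f\<close>.\<close>
    have right: "f x < f y" if "x < y" "c 3 \<le> x" "y \<le> c 4" for x y
    proof -
      have "F y < F x" using monotone_onD[OF lap4, of x y] that by simp
      then have "h12 (F x) < h12 (F y)"
        using that order F_0d[of x] F_0d[of y] by (intro monotone_onD[OF h12(2)]) auto
      then show ?thesis using that order by (simp add: f_mid)
    qed
    have "f x < f y" if "x < y" "c 2 < x" "y < c 4" for x y
      using left[of x y] right[of x y] left[of x "c 3"] right[of "c 3" y] that by fastforce
    then have "strictly_monotone_on ({c 2<..<c 4} \<inter> {a..b}) f"
      by (auto simp: strictly_monotone_on_def monotone_on_def)
    moreover have "open {c 2<..<c 4}" "c 3 \<in> {c 2<..<c 4}" using order by auto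
    ultimately show ?thesis unfolding forts_def by blast
  qed
  have c1_fort: "c 1 \<in> forts a b f"
  proof (rule extremum_in_forts)
    show "c 0 < c 1" "c 1 < c 2" "{c 0..c 2} \<subseteq> {a..b}" using order by auto
    have "f x \<le> f (c 1)" if "x \<in> {c 0..c 2}" for x
    proof (cases "x \<le> c 1")
      case True
      then show ?thesis using strict_mono_on_leD[OF mono_f, of x "c 1"] that order by simp
    next
      case False
      then show ?thesis using monotone_onD[OF A12, of "c 1" x] that order by (simp add: f_left)
    qed
    then show "(\<forall>x\<in>{c 0..c 2}. f x \<le> f (c 1)) \<or> (\<forall>x\<in>{c 0..c 2}. f (c 1) \<le> f x)" by blast
  qed
  have forts_f: "forts a b f \<subseteq> forts a b F - {c 3}"
  proof -
    have "x \<notin> forts a b f" if x: "x \<in> {a<..<b}" "x \<notin> forts a b F" for x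
    proof -
      have "x \<noteq> c 3" using x c_fort[of 3] u by auto
      \<comment> \<open>The joint \<open>c u\<close> is a fort of \<open>F\<close>, or is the
        endpoint \<open>b\<close> when \<open>u = v + 1\<close>; so \<open>x\<close> lies strictly
        inside one piece.\<close>
      moreover have "x \<noteq> c u" using x c_fort[of u] u assms(4) by (cases "u = v + 1") auto
      ultimately consider "x < c 3" | "c 3 < x" "x < c u" | "c u < x" by linarith
      then show ?thesis
      proof cases
        case 1
        show ?thesis
          by (rule not_fort_compose[OF x, of "{..<c 3}" _ \<psi> "{e..d}"])
            (use 1 F_ed \<psi>(2) order in \<open>auto simp: f_left A_def strictly_monotone_on_def\<close>)
      next
        case 2
        show ?thesis
          by (rule not_fort_compose[OF x, of "{c 3<..<c u}" _ h12 "{c 0..d}"])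
            (use 2 F_0d h12(2) order in \<open>auto simp: f_mid strictly_monotone_on_def\<close>)
      next
        case 3
        show ?thesis
          by (rule not_fort_compose[OF x, of "{c u<..}" _ h23 "{c 0..c 1}"])
            (use 3 rangeF h23(2) order in \<open>auto simp: f_right strictly_monotone_on_def\<close>)
      qed
    qed
    moreover have "forts a b f \<subseteq> {a<..<b}" by (auto simp: forts_def)
    ultimately show ?thesis using c3_fort by blast
  qed
  have "finite (forts a b f)" using forts_f finF by (meson finite_Diff finite_subset)
  have "f \<in> PM a b"
    using contf f_values order \<open>finite (forts a b f)\<close> by (force simp: PM_def)
  moreover have "height a b f = 2"
  proof (rule height_eq_2)
    show "num_forts a b f \<noteq> 0"
      using c1_fort \<open>finite (forts a b f)\<close> by (auto simp: num_forts_def)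
    have forts_2: "forts a b (f ^^ 2) = forts a b F"
      by (rule forts_cong) (simp add: numeral_2_eq_2 f_root)
    have "c 3 \<in> forts a b F" using c_fort[of 3] u by simp
    then have "forts a b f \<subset> forts a b F" using forts_f by blast
    then have "card (forts a b f) < card (forts a b F)" by (rule psubset_card_mono[OF finF])
    then show "num_forts a b f \<noteq> num_forts a b (f ^^ 2)" by (simp add: num_forts_def forts_2)
    \<comment> \<open>On \<open>[a, b]\<close> the third iterate is \<open>f\<close> after
      \<open>F\<close>, and \<open>f\<close> is increasing on the interval containing the range of
      \<open>F\<close>.\<close>
    have "strictly_monotone_on (F ` {a..b}) f"
      by (rule strictly_monotone_on_subset[of "{c 0..c 1}"])
        (use mono_f rangeF in \<open>auto simp: strictly_monotone_on_def\<close>)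
    then have "forts a b (\<lambda>x. f (F x)) = forts a b F" by (rule forts_compose)
    moreover have "forts a b (f ^^ 3) = forts a b (\<lambda>x. f (F x))"
      by (rule forts_cong) (simp add: numeral_3_eq_3 f_root)
    ultimately show "num_forts a b (f ^^ 2) = num_forts a b (f ^^ 3)"
      by (simp add: num_forts_def forts_2)
  qed
  ultimately show ?thesis using f_root mono_f by auto
qed

end
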